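(* Let $\mathbb{L}^3$ be $\mathbb{R}^3$ with coordinates $(x,y,z)$ and the metric $g=-2\,dx\,dy+dz^2$. Let $\psi:I\times\mathbb{R}\to\mathbb{L}^3$, $\psi=\psi(s,t)$, $$\psi(s,t)=\left(x(s)+\tfrac{t^2}{2}y(s),\,y(s),\,t\,y(s)\right),$$ be an $A_3$-invariant surface such that it is a translating soliton on the parallel light-like direction $\vec{K}=(1,0,0)$. Then the profile curve $\alpha:I\subset\mathbb{R}\to\mathbb{L}^3$, $\alpha(s)=(x(s),y(s),0)$, of $\psi(s,t)$ is one of the following: 1. For $y(s)=s$ $(\neq0)$, given $a_0,a_1\in\mathbb{R}$, $a_0\neq0$, $x(s)=a_0(2s^2+2s+1)e^{-2s}+a_1$. In addition, $\psi$ is space-like if and only if $a_0>0$, and time-like if and only if $a_0<0$. 2. For $x(s)=s$, given $b_2,b_3\in\mathbb{R}$, $b_2\neq0$, and the diffeomorphism $\phi:\mathbb{R}\to(0,+\infty)$, $\phi(r)=(2r^2+2r+1)e^{-2r}$, $$y:J\to\mathbb{R},\qquad y(s)=\phi^{-1}(-4b_2s+b_3),$$ where the interval $J$ is included in either $J\subseteq\left(-\infty,\frac{b_3}{4b_2}\right)\setminus\{1\}$, if $b_2>0$, or $J\subseteq\left(\frac{b_3}{4b_2},+\infty\right)\setminus\{1\}$, if $b_2<0$. In addition, $\psi$ is space-like if and only if $b_2<0$, and time-like if and only if $b_2>0$.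
   Context: $A_3=\{\xi_t:t\in\mathbb{R}\}$ is the one-parameter group of isometries of $\mathbb{L}^3$ acting by $\xi_t\cdot(x,y,z)=\left(x+\tfrac{t^2}{2}y+tz,\;y,\;ty+z\right)$, which fixes the light-like axis spanned by $(1,0,0)$. An $A_3$-invariant surface is obtained as $\psi(s,t)=\xi_t\cdot\alpha(s)$ from a smooth regular profile curve $\alpha(s)=(x(s),y(s),0)$, defined on an interval $I$ and contained in one of the open half planes $\{(x,y,0):y>0\}$ or $\{(x,y,0):y<0\}$. The induced metric is assumed non-degenerate, so that $x'(s)y'(s)\neq0$ for all $s$, and the profile curve is expressed as a graph, with either $y(s)=s$ or $x(s)=s$; $J$ denotes the interval of definition in the case $x(s)=s$. The surface is space-like (respectively time-like) if the induced metric $\psi^*g$ is Riemannian (respectively Lorentzian). Given a parallel light-like vector $\vec{K}$ in $\mathbb{L}^3$, a non-degenerate immersion $\psi:M\to\mathbb{L}^3$ of a surface is called a translating soliton on the light-like direction $\vec{K}$ if its mean curvature vector $\vec{H}$ satisfies $\vec{H}=\vec{K}^{\perp}$, where $\perp$ is the orthogonal projection on the normal bundle. The mean curvature vector is the (non-normalized) trace $\vec{H}=\mathrm{trace}(\sigma)$, taken with respect to the induced metric, of the second fundamental form $\sigma(X,Y)=(\nabla^o_XY)^{\perp}$, with $\nabla^o$ the Levi-Civita connection of $\mathbb{L}^3$.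
   Formalization: In case 2 the point removed from the half-line is (b_3-1)/(4b_2), where y would vanish, instead of 1; and φ, whose derivative vanishes at 0, is claimed to be a smooth homeomorphism R→(0,∞) and a diffeomorphism only from R\{0} onto (0,∞)\{1}. *)

theory Defs
  imports "HOL-Analysis.Analysis"
begin

section \<open>Smooth maps on open sets\<close>

text \<open>On an open set, a map is \<open>C\<^sup>n\<^sup>+\<^sup>1\<close> iff it is differentiable and all its directional
  derivatives are \<open>C\<^sup>n\<close>. The derivative is the two-sided one, so these notions are meant for
  open sets only.\<close>

primrec Ck_on :: "nat \<Rightarrow> 'a::euclidean_space set \<Rightarrow> ('a \<Rightarrow> 'b::euclidean_space) \<Rightarrow> bool" where
  "Ck_on 0 U f \<longleftrightarrow> continuous_on U f"
| "Ck_on (Suc n) U f \<longleftrightarrow>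
     (\<forall>p\<in>U. f differentiable (at p)) \<and>
     (\<forall>v. Ck_on n U (\<lambda>p. frechet_derivative f (at p) v))"

definition smooth_on :: "'a::euclidean_space set \<Rightarrow> ('a \<Rightarrow> 'b::euclidean_space) \<Rightarrow> bool" where
  "smooth_on U f \<longleftrightarrow> (\<forall>n. Ck_on n U f)"

definition diffeomorphism ::
  "'a::euclidean_space set \<Rightarrow> 'b::euclidean_space set \<Rightarrow> ('a \<Rightarrow> 'b) \<Rightarrow> ('b \<Rightarrow> 'a) \<Rightarrow> bool" where
  "diffeomorphism S T f g \<longleftrightarrow> homeomorphism S T f g \<and> smooth_on S f \<and> smooth_on T g"


section \<open>The Lorentz-Minkowski space in null coordinates\<close>

text \<open>The polarization of \<open>-2 dx dy + dz\<^sup>2\<close>.\<close>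

definition lmetric :: "real ^ 3 \<Rightarrow> real ^ 3 \<Rightarrow> real" where
  "lmetric u v = - (u $ 1 * v $ 2) - u $ 2 * v $ 1 + u $ 3 * v $ 3"

definition light_like :: "real ^ 3 \<Rightarrow> bool" where
  "light_like v \<longleftrightarrow> v \<noteq> 0 \<and> lmetric v v = 0"


section \<open>Parametrized surfaces\<close>

abbreviation dmap :: "(real ^ 2 \<Rightarrow> real ^ 3) \<Rightarrow> real ^ 2 \<Rightarrow> real ^ 2 \<Rightarrow> real ^ 3" where
  "dmap \<psi> p \<equiv> frechet_derivative \<psi> (at p)"

definition induced_metric ::
  "(real ^ 2 \<Rightarrow> real ^ 3) \<Rightarrow> real ^ 2 \<Rightarrow> real ^ 2 \<Rightarrow> real ^ 2 \<Rightarrow> real" where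
  "induced_metric \<psi> p u v = lmetric (dmap \<psi> p u) (dmap \<psi> p v)"

definition immersion_on :: "(real ^ 2) set \<Rightarrow> (real ^ 2 \<Rightarrow> real ^ 3) \<Rightarrow> bool" where
  "immersion_on U \<psi> \<longleftrightarrow> smooth_on U \<psi> \<and> (\<forall>p\<in>U. inj (dmap \<psi> p))"

definition nondegenerate_on :: "(real ^ 2) set \<Rightarrow> (real ^ 2 \<Rightarrow> real ^ 3) \<Rightarrow> bool" where
  "nondegenerate_on U \<psi> \<longleftrightarrow>
     (\<forall>p\<in>U. \<forall>u. (\<forall>v. induced_metric \<psi> p u v = 0) \<longrightarrow> u = 0)"

definition space_like_on :: "(real ^ 2) set \<Rightarrow> (real ^ 2 \<Rightarrow> real ^ 3) \<Rightarrow> bool" where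
  "space_like_on U \<psi> \<longleftrightarrow> (\<forall>p\<in>U. \<forall>u. u \<noteq> 0 \<longrightarrow> induced_metric \<psi> p u u > 0)"

text \<open>Lorentzian means signature \<open>(1,1)\<close>, i.e. every tangent plane has a pseudo-orthonormal
  basis (linear independence of \<open>u\<close> and \<open>v\<close> is automatic).\<close>

definition time_like_on :: "(real ^ 2) set \<Rightarrow> (real ^ 2 \<Rightarrow> real ^ 3) \<Rightarrow> bool" where
  "time_like_on U \<psi> \<longleftrightarrow>
     (\<forall>p\<in>U. \<exists>u v. induced_metric \<psi> p u u = -1 \<and> induced_metric \<psi> p v v = 1 \<and>
                  induced_metric \<psi> p u v = 0)"

definition normal_space :: "(real ^ 2 \<Rightarrow> real ^ 3) \<Rightarrow> real ^ 2 \<Rightarrow> (real ^ 3) set" where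
  "normal_space \<psi> p = {n. \<forall>u. lmetric n (dmap \<psi> p u) = 0}"

text \<open>The orthogonal projection onto the normal space. It is well defined exactly where the
  induced metric of the immersion is non-degenerate.\<close>

definition normal_proj :: "(real ^ 2 \<Rightarrow> real ^ 3) \<Rightarrow> real ^ 2 \<Rightarrow> real ^ 3 \<Rightarrow> real ^ 3" where
  "normal_proj \<psi> p w = (THE n. n \<in> normal_space \<psi> p \<and> w - n \<in> range (dmap \<psi> p))"

text \<open>\<open>\<sigma>(X,Y) = (\<nabla>\<^sup>o\<^sub>X Y)\<^sup>\<bottom>\<close>. Since the metric has constant coefficients, \<open>\<nabla>\<^sup>o\<close> is componentwise
  differentiation. As \<open>\<sigma>\<close> is tensorial, the tangent vectors \<open>d\<psi>(u)\<close>, \<open>d\<psi>(v)\<close> at \<open>p\<close> are extended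
  by the fields coming from the constant fields \<open>u\<close>, \<open>v\<close> on the parameter domain.\<close>

definition second_fundamental_form ::
  "(real ^ 2 \<Rightarrow> real ^ 3) \<Rightarrow> real ^ 2 \<Rightarrow> real ^ 2 \<Rightarrow> real ^ 2 \<Rightarrow> real ^ 3" where
  "second_fundamental_form \<psi> p u v =
     normal_proj \<psi> p (frechet_derivative (\<lambda>q. dmap \<psi> q v) (at p) u)"

definition gram :: "(real ^ 2 \<Rightarrow> real ^ 3) \<Rightarrow> real ^ 2 \<Rightarrow> real ^ 2 ^ 2" where
  "gram \<psi> p = (\<chi> i j. induced_metric \<psi> p (axis i 1) (axis j 1))"

text \<open>The non-normalized trace \<open>\<Sum> g\<^sup>i\<^sup>j \<sigma>\<^sub>i\<^sub>j\<close>.\<close>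

definition mean_curvature_vector :: "(real ^ 2 \<Rightarrow> real ^ 3) \<Rightarrow> real ^ 2 \<Rightarrow> real ^ 3" where
  "mean_curvature_vector \<psi> p =
     (\<Sum>i\<in>UNIV. \<Sum>j\<in>UNIV. matrix_inv (gram \<psi> p) $ i $ j *\<^sub>R
        second_fundamental_form \<psi> p (axis i 1) (axis j 1))"

definition translating_soliton ::
  "real ^ 3 \<Rightarrow> (real ^ 2) set \<Rightarrow> (real ^ 2 \<Rightarrow> real ^ 3) \<Rightarrow> bool" where
  "translating_soliton K U \<psi> \<longleftrightarrow>
     light_like K \<and> immersion_on U \<psi> \<and> nondegenerate_on U \<psi> \<and>
     (\<forall>p\<in>U. mean_curvature_vector \<psi> p = normal_proj \<psi> p K)"


section \<open>Surfaces invariant under the parabolic group\<close>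

definition xi :: "real \<Rightarrow> real ^ 3 \<Rightarrow> real ^ 3" where
  "xi t v = vector [v $ 1 + t\<^sup>2 / 2 * v $ 2 + t * v $ 3, v $ 2, t * v $ 2 + v $ 3]"

definition profile :: "(real \<Rightarrow> real) \<Rightarrow> (real \<Rightarrow> real) \<Rightarrow> real \<Rightarrow> real ^ 3" where
  "profile x y s = vector [x s, y s, 0]"

definition profile_curve_on :: "real set \<Rightarrow> (real \<Rightarrow> real) \<Rightarrow> (real \<Rightarrow> real) \<Rightarrow> bool" where
  "profile_curve_on I x y \<longleftrightarrow>
     smooth_on I (profile x y) \<and>
     (\<forall>s\<in>I. vector_derivative (profile x y) (at s) \<noteq> 0) \<and>
     ((\<forall>s\<in>I. y s > 0) \<or> (\<forall>s\<in>I. y s < 0))"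

text \<open>The parameters \<open>(s,t)\<close> are the two coordinates of \<open>p\<close>.\<close>

definition A3_surface :: "(real \<Rightarrow> real) \<Rightarrow> (real \<Rightarrow> real) \<Rightarrow> real ^ 2 \<Rightarrow> real ^ 3" where
  "A3_surface x y p = xi (p $ 2) (profile x y (p $ 1))"

definition strip :: "real set \<Rightarrow> (real ^ 2) set" where
  "strip I = {p. p $ 1 \<in> I}"

lemma A3_surface_eq:
  "A3_surface x y (vector [s, t]) = vector [x s + t\<^sup>2 / 2 * y s, y s, t * y s]"
  by (simp add: A3_surface_def xi_def profile_def)

definition phi :: "real \<Rightarrow> real" where
  "phi r = (2 * r\<^sup>2 + 2 * r + 1) * exp (- 2 * r)"

text \<open>\<open>phi\<close> is a smooth bijection from the reals onto the positive reals, but its derivative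
  \<open>-4 r\<^sup>2 exp (-2 r)\<close> vanishes at \<open>0\<close>, so \<open>inv phi\<close> is not differentiable at \<open>phi 0 = 1\<close>.
  It is a diffeomorphism only away from \<open>0\<close>. Correspondingly, a function \<open>inv phi (- 4 b s + c)\<close> vanishes
  exactly at \<open>s = (c - 1) / (4 b)\<close>.\<close>

end

theory Submission
  imports Defs "HOL-Real_Asymp.Real_Asymp"
begin

text \<open>Write \<open>\<langle>u, v\<rangle>\<close> for the metric. The tangent vectors
  \<open>\<psi>\<^sub>s = (x' + t\<^sup>2 y' / 2, y', t y')\<close> and \<open>\<psi>\<^sub>t = (t y, 0, y)\<close> are orthogonal, with
  \<open>\<langle>\<psi>\<^sub>s, \<psi>\<^sub>s\<rangle> = - 2 x' y'\<close> and \<open>\<langle>\<psi>\<^sub>t, \<psi>\<^sub>t\<rangle> = y\<^sup>2\<close>, and the normal line is spanned by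
  \<open>N = (- x' + t\<^sup>2 y' / 2, y', t y')\<close>, for which \<open>\<langle>N, N\<rangle> = 2 x' y'\<close>. Hence the trace of the second
  fundamental form only sees \<open>\<psi>\<^sub>s\<^sub>s\<close> and \<open>\<psi>\<^sub>t\<^sub>t\<close>, and comparing the coefficients of \<open>N\<close> in
  \<open>H = K\<^sup>\<bottom>\<close> leaves one equation in which \<open>t\<close> does not occur (\<open>soliton_equation\<close>):
  \<open>x'' / x' - y'' / y' = 2 y' / y - 2 y'\<close>.

  Both sides are logarithmic derivatives, so \<open>x' / y'\<close> is a constant multiple of
  \<open>y\<^sup>2 exp (- 2 y)\<close>, which up to the factor \<open>- 4\<close> is the derivative of \<open>phi\<close> at \<open>y\<close>. A second
  integration gives \<open>x = a * phi y + k\<close> with \<open>a \<noteq> 0\<close> (\<open>soliton_first_integral\<close>), and this one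
  relation contains both graph cases: \<open>y s = s\<close> gives the first, and solving for \<open>y\<close> when
  \<open>x s = s\<close> gives the second, with \<open>b2 = - 1 / (4 * a)\<close> and \<open>b3 = - k / a\<close>. Since \<open>x' y'\<close> has the
  sign of \<open>- a\<close> and \<open>y\<^sup>2 > 0\<close>, the diagonal form of the metric gives the causal character.

  For \<open>phi\<close> itself, strict monotonicity and the limits at both ends make it a homeomorphism onto
  the positive reals. Away from \<open>0\<close> its derivative does not vanish; there the derivative of the
  inverse is a smooth function of the inverse, and smoothness follows by bootstrapping
  (\<open>Ck_on_inverse_function\<close>).\<close>

section \<open>Smooth functions of one real variable\<close>

lemma Ck_on_cong:
  assumes "open U" "\<And>p. p \<in> U \<Longrightarrow> f p = g p" "Ck_on n U f"
  shows "Ck_on n U g"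
  using assms(2,3)
proof (induction n arbitrary: f g)
  case 0
  then show ?case by (simp cong: continuous_on_cong)
next
  case (Suc n)
  have D: "(g has_derivative frechet_derivative f (at p)) (at p)" if "p \<in> U" for p
  proof (rule has_derivative_transform_within_open[OF _ \<open>open U\<close> that])
    show "(f has_derivative frechet_derivative f (at p)) (at p)"
      using Suc.prems that by (simp add: frechet_derivative_works)
  qed (use Suc.prems in auto)
  have eq: "frechet_derivative g (at p) = frechet_derivative f (at p)" if "p \<in> U" for p
    using frechet_derivative_at[OF D[OF that]] by simp
  have "Ck_on n U (\<lambda>p. frechet_derivative g (at p) v)" for v
    by (rule Suc.IH[of "\<lambda>p. frechet_derivative f (at p) v"])
       (simp add: eq, use Suc.prems in simp)
  then show ?case
    using D by (auto simp: differentiable_def)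
qed

lemma Ck_on_const [simp]: "Ck_on n U (\<lambda>_. c)"
  by (induction n arbitrary: c) (auto simp: frechet_derivative_const)

lemma Ck_on_SucD:
  assumes "Ck_on (Suc n) U f" "open U"
  shows "Ck_on n U f"
  using assms(1)
proof (induction n arbitrary: f)
  case 0
  then show ?case
    by (auto intro!: continuous_at_imp_continuous_on differentiable_imp_continuous_within)
next
  case (Suc n)
  then show ?case by (auto simp del: Ck_on.simps simp add: Ck_on.simps(2))
qed

text \<open>Directional derivatives of a function of one variable are multiples of the ordinary derivative.
  This lemma and its converse \<open>Ck_on_SucI\<close> reduce smoothness proofs to calculus with ordinary
  derivatives.\<close>

lemma Ck_on_Suc_deriv:
  fixes f :: "real \<Rightarrow> real"
  assumes "open U" "Ck_on (Suc n) U f"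
  shows "\<exists>f'. (\<forall>p\<in>U. (f has_real_derivative f' p) (at p)) \<and> Ck_on n U f'"
proof (intro exI conjI ballI)
  show "Ck_on n U (\<lambda>p. frechet_derivative f (at p) 1)" using assms by simp
  fix p assume "p \<in> U"
  then have D: "(f has_derivative frechet_derivative f (at p)) (at p)"
    using assms by (simp add: frechet_derivative_works)
  then interpret bounded_linear "frechet_derivative f (at p)"
    by (rule has_derivative_bounded_linear)
  have "frechet_derivative f (at p) = (*) (frechet_derivative f (at p) 1)"
  proof
    fix h show "frechet_derivative f (at p) h = frechet_derivative f (at p) 1 * h"
      using scaleR[of h 1] by simp
  qed
  then show "(f has_real_derivative frechet_derivative f (at p) 1) (at p)"
    using D by (simp add: has_field_derivative_def)
qed

lemma Ck_on_add:
  fixes f g :: "real \<Rightarrow> real"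
  assumes "open U" "Ck_on n U f" "Ck_on n U g"
  shows "Ck_on n U (\<lambda>p. f p + g p)"
  using assms(2,3)
proof (induction n arbitrary: f g)
  case 0
  then show ?case by (auto intro: continuous_intros)
next
  case (Suc n)
  have D: "frechet_derivative (\<lambda>p. f p + g p) (at p)
      = (\<lambda>v. frechet_derivative f (at p) v + frechet_derivative g (at p) v)" if "p \<in> U" for p
    using Suc.prems that by (intro frechet_derivative_at[symmetric] has_derivative_add)
      (auto simp: frechet_derivative_works)
  have "Ck_on n U (\<lambda>p. frechet_derivative f (at p) v + frechet_derivative g (at p) v)" for v
    by (rule Suc.IH) (use Suc.prems in simp_all)
  then have "Ck_on n U (\<lambda>p. frechet_derivative (\<lambda>p. f p + g p) (at p) v)" for v
    by (rule Ck_on_cong[OF \<open>open U\<close>, rotated]) (simp add: D)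
  then show ?case using Suc.prems by simp
qed

lemma Ck_on_mult:
  fixes f g :: "real \<Rightarrow> real"
  assumes "open U" "Ck_on n U f" "Ck_on n U g"
  shows "Ck_on n U (\<lambda>p. f p * g p)"
  using assms(2,3)
proof (induction n arbitrary: f g)
  case 0
  then show ?case by (auto intro: continuous_intros)
next
  case (Suc n)
  \<comment> \<open>The product rule keeps one factor undifferentiated, so the lower order must be available for it.\<close>
  note C = Ck_on_SucD[OF _ \<open>open U\<close>]
  have D: "frechet_derivative (\<lambda>p. f p * g p) (at p)
      = (\<lambda>v. f p * frechet_derivative g (at p) v + frechet_derivative f (at p) v * g p)"
    if "p \<in> U" for p
    using Suc.prems that by (intro frechet_derivative_at[symmetric] has_derivative_mult)
      (auto simp: frechet_derivative_works)
  have "Ck_on n U (\<lambda>p. f p * frechet_derivative g (at p) v + frechet_derivative f (at p) v * g p)" for v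
    using Suc.prems C[OF Suc.prems(1)] C[OF Suc.prems(2)]
    by (intro Ck_on_add[OF \<open>open U\<close>] Suc.IH) simp_all
  then have "Ck_on n U (\<lambda>p. frechet_derivative (\<lambda>p. f p * g p) (at p) v)" for v
    by (rule Ck_on_cong[OF \<open>open U\<close>, rotated]) (simp add: D)
  then show ?case using Suc.prems by simp
qed

lemma Ck_on_SucI:
  fixes f f' :: "real \<Rightarrow> real"
  assumes "open U" "\<And>p. p \<in> U \<Longrightarrow> (f has_real_derivative f' p) (at p)" "Ck_on n U f'"
  shows "Ck_on (Suc n) U f"
proof -
  have D: "frechet_derivative f (at p) = (\<lambda>v. f' p * v)" if "p \<in> U" for p
    using assms(2)[OF that] by (metis frechet_derivative_at has_field_derivative_def)
  have "Ck_on n U (\<lambda>p. frechet_derivative f (at p) v)" for v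
    by (rule Ck_on_cong[OF \<open>open U\<close> _ Ck_on_mult[OF \<open>open U\<close> assms(3) Ck_on_const[of n U v]]])
       (simp add: D)
  then show ?thesis
    using assms(2) by (auto intro: differentiableI simp: has_field_derivative_def)
qed

lemma Ck_on_compose:
  fixes f g :: "real \<Rightarrow> real"
  assumes "open U" "open V" "g ` U \<subseteq> V" "Ck_on n V f" "Ck_on n U g"
  shows "Ck_on n U (\<lambda>p. f (g p))"
  using assms(4,5)
proof (induction n arbitrary: f)
  case 0
  then show ?case using continuous_on_compose2[of V f U g] assms(3) by simp
next
  case (Suc n)
  obtain f' where f': "\<And>p. p \<in> V \<Longrightarrow> (f has_real_derivative f' p) (at p)" "Ck_on n V f'"
    using Ck_on_Suc_deriv[OF \<open>open V\<close> Suc.prems(1)] by blast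
  obtain g' where g': "\<And>p. p \<in> U \<Longrightarrow> (g has_real_derivative g' p) (at p)" "Ck_on n U g'"
    using Ck_on_Suc_deriv[OF \<open>open U\<close> Suc.prems(2)] by blast
  show ?case
  proof (rule Ck_on_SucI[OF \<open>open U\<close>])
    show "((\<lambda>p. f (g p)) has_real_derivative f' (g p) * g' p) (at p)" if "p \<in> U" for p
      by (rule DERIV_chain2[OF f'(1) g'(1)[OF that]]) (use assms(3) that in auto)
    show "Ck_on n U (\<lambda>p. f' (g p) * g' p)"
      by (rule Ck_on_mult[OF \<open>open U\<close> Suc.IH[OF f'(2) Ck_on_SucD[OF Suc.prems(2) \<open>open U\<close>]] g'(2)])
  qed
qed

lemma Ck_on_ident: "open U \<Longrightarrow> Ck_on n U (\<lambda>p::real. p)"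
  by (cases n) (auto simp del: Ck_on.simps(2) intro!: Ck_on_SucI[of _ _ "\<lambda>_. 1"])

lemma Ck_on_inverse:
  fixes U :: "real set"
  assumes "open U" "0 \<notin> U"
  shows "Ck_on n U (\<lambda>p. inverse p)"
proof (induction n)
  case 0
  show ?case using assms by (auto intro!: continuous_intros)
next
  case (Suc n)
  show ?case
  proof (rule Ck_on_SucI[OF \<open>open U\<close>])
    show "(inverse has_real_derivative (- 1) * (inverse p * inverse p)) (at p)" if "p \<in> U" for p
      using that assms by (auto intro!: derivative_eq_intros)
    show "Ck_on n U (\<lambda>p. (- 1) * (inverse p * inverse p))"
      by (intro Ck_on_mult \<open>open U\<close> Suc Ck_on_const)
  qed
qed

lemma Ck_on_exp:
  fixes U :: "real set"
  assumes "open U"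
  shows "Ck_on n U (\<lambda>p. exp p)"
proof (induction n)
  case 0
  show ?case by (auto intro!: continuous_intros)
next
  case (Suc n)
  then show ?case by (intro Ck_on_SucI[OF assms]) auto
qed

text \<open>The equation \<open>g' = inverse (f' \<circ> g)\<close> gains one order of differentiability of \<open>g\<close> at each
  step of the induction.\<close>

lemma Ck_on_inverse_function:
  fixes f' g :: "real \<Rightarrow> real"
  assumes "open U" "open V" "g ` V \<subseteq> U" "\<And>n. Ck_on n U f'" "\<And>r. r \<in> U \<Longrightarrow> f' r \<noteq> 0"
    and "\<And>q. q \<in> V \<Longrightarrow> (g has_real_derivative inverse (f' (g q))) (at q)"
  shows "Ck_on n V g"
proof (induction n)
  case 0
  show ?case
    using assms(6) by (auto intro!: continuous_at_imp_continuous_on DERIV_isCont)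
next
  case (Suc n)
  show ?case
  proof (rule Ck_on_SucI[OF \<open>open V\<close> assms(6)])
    have "Ck_on n V (\<lambda>q. f' (g q))"
      by (rule Ck_on_compose[OF \<open>open V\<close> \<open>open U\<close> assms(3,4) Suc])
    then show "Ck_on n V (\<lambda>q. inverse (f' (g q)))"
      by (rule Ck_on_compose[OF \<open>open V\<close> _ _ Ck_on_inverse[of "- {0}"], rotated -1])
         (use assms(3,5) in auto)
  qed
qed


section \<open>The function phi\<close>

lemma phi_deriv: "(phi has_real_derivative (- 4 * r\<^sup>2 * exp (- 2 * r))) (at r)"
proof -
  have "((\<lambda>r. (2 * r\<^sup>2 + 2 * r + 1) * exp (- 2 * r)) has_real_derivative (- 4 * r\<^sup>2 * exp (- 2 * r))) (at r)"
    by (rule derivative_eq_intros refl)+ (simp add: algebra_simps power2_eq_square)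
  then show ?thesis by (simp add: phi_def[abs_def])
qed

lemma continuous_on_phi: "continuous_on S phi"
  using phi_deriv by (auto intro!: continuous_at_imp_continuous_on DERIV_isCont)

text \<open>The derivative is negative except at \<open>0\<close>, so an interval with \<open>0\<close> inside is cut there.\<close>

lemma phi_strict_decreasing:
  assumes "a < b"
  shows "phi b < phi a"
proof -
  have *: "phi v < phi u" if "u < v" "0 \<notin> {u<..<v}" for u v
    using \<open>u < v\<close>
  proof (rule DERIV_neg_imp_decreasing_open[OF _ _ continuous_on_phi])
    fix r assume "u < r" "r < v"
    then have "r \<noteq> 0" using that by auto
    then show "\<exists>D. (phi has_real_derivative D) (at r) \<and> D < 0"
      using phi_deriv[of r] by (intro exI[of _ "- 4 * r\<^sup>2 * exp (- 2 * r)"]) auto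
  qed
  show ?thesis
  proof (cases "0 \<in> {a<..<b}")
    case True
    then show ?thesis using *[of a 0] *[of 0 b] by auto
  qed (use * assms in auto)
qed

lemma inj_phi: "inj phi"
  by (metis injI linorder_neqE_linordered_idom order_less_irrefl phi_strict_decreasing)

lemma phi_pos: "phi r > 0"
proof -
  have "2 * r\<^sup>2 + 2 * r + 1 = r\<^sup>2 + (r + 1)\<^sup>2" by (simp add: power2_eq_square algebra_simps)
  also have "\<dots> > 0" by (cases "r = 0") (auto simp: add_pos_nonneg)
  finally show ?thesis by (simp add: phi_def)
qed

lemma range_phi: "range phi = {0<..}"
proof -
  have "q \<in> range phi" if "q > 0" for q
  proof -
    have "(phi \<longlongrightarrow> 0) at_top" "filterlim phi at_top at_bot"
      unfolding phi_def[abs_def] by real_asymp+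
    then have "eventually (\<lambda>r. phi r < q) at_top" "eventually (\<lambda>r. q < phi r) at_bot"
      using that by (auto dest: order_tendstoD simp: filterlim_at_top_dense)
    then obtain a b where "\<And>r. r \<ge> b \<Longrightarrow> phi r < q" "\<And>r. r \<le> a \<Longrightarrow> q < phi r"
      by (auto simp: eventually_at_top_linorder eventually_at_bot_linorder)
    then have "phi (max a b) \<le> q" "q \<le> phi a" by (auto intro: less_imp_le)
    then obtain r where "phi r = q"
      using IVT2'[of phi "max a b" q a] continuous_on_phi by auto
    then show ?thesis by auto
  qed
  then show ?thesis using phi_pos by auto
qed

lemma homeomorphism_phi: "homeomorphism UNIV {0<..} phi (inv phi)"
proof -
  obtain g where g: "homeomorphism UNIV {0<..} phi g"
    using homeomorphism_into_1d[OF _ continuous_on_phi range_phi inj_phi] by auto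
  have "inv phi q = g q" if "q > 0" for q
    using g that by (intro inv_f_eq inj_phi) (auto simp: homeomorphism_def)
  then show ?thesis using homeomorphism_cong[OF g] by auto
qed

lemma Ck_on_phi_deriv: "open U \<Longrightarrow> Ck_on n U (\<lambda>r::real. - 4 * r\<^sup>2 * exp (- 2 * r))"
proof -
  assume U: "open U"
  have "Ck_on n U (\<lambda>r. - 2 * r)" for n
    by (rule Ck_on_mult[OF U Ck_on_const Ck_on_ident[OF U]])
  then have e: "Ck_on n U (\<lambda>r. exp (- 2 * r))"
    by (rule Ck_on_compose[OF U open_UNIV subset_UNIV Ck_on_exp[OF open_UNIV]])
  have "Ck_on n U (\<lambda>r. - 4 * r\<^sup>2)"
    unfolding power2_eq_square
    by (rule Ck_on_mult[OF U Ck_on_const Ck_on_mult[OF U Ck_on_ident[OF U] Ck_on_ident[OF U]]])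
  then show ?thesis
    by (rule Ck_on_mult[OF U _ e])
qed

lemma smooth_on_phi:
  assumes "open U"
  shows "smooth_on U phi"
  unfolding smooth_on_def
  by (rule allI, rule Ck_on_SucD[OF Ck_on_SucI[OF assms phi_deriv Ck_on_phi_deriv[OF assms]] assms])

lemma phi_0 [simp]: "phi 0 = 1"
  by (simp add: phi_def)

lemma inv_phi_phi [simp]: "inv phi (phi r) = r"
  by (simp add: inj_phi)

lemma phi_inv_phi: "q > 0 \<Longrightarrow> phi (inv phi q) = q"
  using range_phi by (intro f_inv_into_f) auto

lemma diffeomorphism_phi: "diffeomorphism (- {0}) ({0<..} - {1}) phi (inv phi)"
proof -
  have ne0: "inv phi q \<noteq> 0" if "q > 0" "q \<noteq> 1" for q
    using phi_inv_phi[of q] that by auto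
  have D: "(inv phi has_real_derivative inverse (- 4 * (inv phi q)\<^sup>2 * exp (- 2 * inv phi q))) (at q)"
    if "q \<in> {0<..} - {1}" for q
  proof (rule has_field_derivative_inverse_basic[OF phi_deriv])
    show "continuous (at q) (inv phi)"
      using homeomorphism_phi that by (auto simp: homeomorphism_def continuous_on_eq_continuous_at)
    show "phi (inv phi z) = z" if "z \<in> {0<..}" for z using that by (simp add: phi_inv_phi)
  qed (use ne0[of q] that in auto)
  have "Ck_on n ({0<..} - {1}) (inv phi)" for n
  proof (rule Ck_on_inverse_function)
    show "open (- {0::real})" "open ({0<..} - {1::real})" by (auto simp: open_Diff)
    show "inv phi ` ({0<..} - {1}) \<subseteq> - {0}"
      by (rule image_subsetI) (use ne0 in simp)
    show "Ck_on n (- {0}) (\<lambda>r::real. - 4 * r\<^sup>2 * exp (- 2 * r))" for n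
      by (rule Ck_on_phi_deriv) auto
  qed (use D in auto)
  moreover have "homeomorphism (- {0}) ({0<..} - {1}) phi (inv phi)"
  proof (rule homeomorphism_of_subsets[OF homeomorphism_phi])
    have "q \<in> phi ` (- {0})" if "q > 0" "q \<noteq> 1" for q
      using phi_inv_phi[of q] ne0[of q] that by (metis ComplI image_eqI singletonD)
    moreover have "phi r \<noteq> 1" if "r \<noteq> 0" for r
      using that inj_phi by (metis injD phi_0)
    ultimately show "phi ` (- {0}) = {0<..} - {1}" using phi_pos by auto
  qed auto
  ultimately show ?thesis
    using smooth_on_phi[OF open_Compl[OF closed_singleton]]
    by (simp add: diffeomorphism_def smooth_on_def)
qed


section \<open>Geometry of an invariant surface\<close>

lemma matrix_inv_eqI:
  fixes A B :: "'a::semiring_1 ^ 'n ^ 'n"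
  assumes "A ** B = mat 1" "B ** A = mat 1"
  shows "matrix_inv A = B"
  unfolding matrix_inv_def
proof (rule some_equality)
  fix C assume "A ** C = mat 1 \<and> C ** A = mat 1"
  then have "C = C ** (A ** B)" by (simp add: assms)
  also have "\<dots> = B" using \<open>_ \<and> C ** A = mat 1\<close> by (simp add: matrix_mul_assoc)
  finally show "C = B" .
qed (use assms in auto)

lemma lmetric_scaleR: "lmetric (k *\<^sub>R u) v = k * lmetric u v"
  by (simp add: lmetric_def algebra_simps)

lemma lmetric_diff: "lmetric (u - u') v = lmetric u v - lmetric u' v"
  by (simp add: lmetric_def algebra_simps)

lemma has_derivative_vector_3:
  fixes a b c :: "'a::real_normed_vector \<Rightarrow> real"
  assumes "(a has_derivative a') F" "(b has_derivative b') F" "(c has_derivative c') F"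
  shows "((\<lambda>p. vector [a p, b p, c p] :: real ^ 3) has_derivative (\<lambda>h. vector [a' h, b' h, c' h])) F"
proof -
  have *: "vector [u, v, w] = u *\<^sub>R (axis 1 1 :: real ^ 3) + v *\<^sub>R axis 2 1 + w *\<^sub>R axis 3 1" for u v w
    by (simp add: vec_eq_iff forall_3 axis_def)
  show ?thesis
    unfolding * by (intro has_derivative_add has_derivative_scaleR_left assms)
qed

lemma has_derivative_coord: "((\<lambda>p::real ^ 'n. p $ i) has_derivative (\<lambda>h. h $ i)) F"
  by (rule bounded_linear.has_derivative[OF bounded_linear_vec_nth has_derivative_ident])

lemma has_derivative_of_coord:
  assumes "(f has_real_derivative f') (at (p $ i))"
  shows "((\<lambda>p::real ^ 'n. f (p $ i)) has_derivative (\<lambda>h. h $ i * f')) (at p)"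
  by (rule DERIV_compose_FDERIV[OF assms has_derivative_coord])

lemma has_derivative_half_square:
  "((\<lambda>p::real ^ 'n. (p $ i)\<^sup>2 / 2) has_derivative (\<lambda>h. h $ i * p $ i)) (at p)"
proof (rule has_derivative_of_coord)
  show "((\<lambda>r::real. r\<^sup>2 / 2) has_real_derivative p $ i) (at (p $ i))"
    by (auto intro!: derivative_eq_intros)
qed

lemma open_strip: "open I \<Longrightarrow> open (strip I)"
  unfolding strip_def
  using open_vimage_vec_nth[of I 1] by (simp add: vimage_def)

text \<open>The equation of a soliton involves only two derivatives of the profile curve; they are named
  here so that the geometry can be computed in coordinates.\<close>

locale A3_twice_differentiable =
  fixes I :: "real set" and x y x1 y1 x2 y2 :: "real \<Rightarrow> real"
  assumes openI: "open I"
    and x1: "\<And>s. s \<in> I \<Longrightarrow> (x has_real_derivative x1 s) (at s)"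
    and y1: "\<And>s. s \<in> I \<Longrightarrow> (y has_real_derivative y1 s) (at s)"
    and x2: "\<And>s. s \<in> I \<Longrightarrow> (x1 has_real_derivative x2 s) (at s)"
    and y2: "\<And>s. s \<in> I \<Longrightarrow> (y1 has_real_derivative y2 s) (at s)"
begin

abbreviation \<psi> :: "real ^ 2 \<Rightarrow> real ^ 3" where "\<psi> \<equiv> A3_surface x y"

definition tangent :: "real ^ 2 \<Rightarrow> real ^ 2 \<Rightarrow> real ^ 3" where
  "tangent p v = vector
    [v $ 1 * (x1 (p $ 1) + (p $ 2)\<^sup>2 / 2 * y1 (p $ 1)) + v $ 2 * (p $ 2 * y (p $ 1)),
     v $ 1 * y1 (p $ 1),
     v $ 1 * (p $ 2 * y1 (p $ 1)) + v $ 2 * y (p $ 1)]"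

text \<open>This vector field satisfies \<open>\<langle>N, N\<rangle> = 2 x' y'\<close>, so it is never light-like where the induced
  metric is non-degenerate.\<close>

definition normal :: "real ^ 2 \<Rightarrow> real ^ 3" where
  "normal p = vector
    [- x1 (p $ 1) + (p $ 2)\<^sup>2 / 2 * y1 (p $ 1), y1 (p $ 1), p $ 2 * y1 (p $ 1)]"

lemma dmap_eq:
  assumes "p \<in> strip I"
  shows "(\<psi> has_derivative tangent p) (at p)" "dmap \<psi> p = tangent p"
proof -
  have s: "p $ 1 \<in> I" using assms by (simp add: strip_def)
  have "((\<lambda>p. vector [x (p $ 1) + (p $ 2)\<^sup>2 / 2 * y (p $ 1), y (p $ 1), p $ 2 * y (p $ 1)])
      has_derivative tangent p) (at p)"
    by (rule has_derivative_eq_rhs[OF has_derivative_vector_3])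
       (rule has_derivative_add has_derivative_mult has_derivative_coord has_derivative_half_square
          has_derivative_of_coord[where f = x, OF x1[OF s]]
          has_derivative_of_coord[where f = y, OF y1[OF s]]
        | simp add: fun_eq_iff tangent_def vec_eq_iff forall_3 algebra_simps)+
  then show "(\<psi> has_derivative tangent p) (at p)"
    by (simp add: A3_surface_def[abs_def] xi_def profile_def)
  then show "dmap \<psi> p = tangent p"
    by (metis frechet_derivative_at)
qed

lemma second_derivative_eq:
  assumes "p \<in> strip I"
  shows "frechet_derivative (\<lambda>q. dmap \<psi> q v) (at p) u = vector
    [u $ 1 * v $ 1 * (x2 (p $ 1) + (p $ 2)\<^sup>2 / 2 * y2 (p $ 1))
       + (u $ 2 * v $ 1 + u $ 1 * v $ 2) * (p $ 2 * y1 (p $ 1)) + u $ 2 * v $ 2 * y (p $ 1),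
     u $ 1 * v $ 1 * y2 (p $ 1),
     u $ 1 * v $ 1 * (p $ 2 * y2 (p $ 1)) + (u $ 2 * v $ 1 + u $ 1 * v $ 2) * y1 (p $ 1)]"
    (is "_ = ?D u")
proof -
  have s: "p $ 1 \<in> I" using assms by (simp add: strip_def)
  have "((\<lambda>q. tangent q v) has_derivative ?D) (at p)"
    unfolding tangent_def
    by (rule has_derivative_eq_rhs[OF has_derivative_vector_3])
       (rule has_derivative_add has_derivative_mult has_derivative_const
          has_derivative_coord has_derivative_half_square
          has_derivative_of_coord[where f = x1, OF x2[OF s]]
          has_derivative_of_coord[where f = y, OF y1[OF s]]
          has_derivative_of_coord[where f = y1, OF y2[OF s]]
        | simp add: fun_eq_iff vec_eq_iff forall_3 algebra_simps)+
  then have "((\<lambda>q. dmap \<psi> q v) has_derivative ?D) (at p)"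
    by (rule has_derivative_transform_within_open[OF _ open_strip[OF openI] assms])
       (simp add: dmap_eq)
  then show ?thesis
    by (rule fun_cong[OF frechet_derivative_at, symmetric])
qed

lemma induced_metric_eq:
  assumes "p \<in> strip I"
  shows "induced_metric \<psi> p u v =
    - 2 * x1 (p $ 1) * y1 (p $ 1) * (u $ 1 * v $ 1) + (y (p $ 1))\<^sup>2 * (u $ 2 * v $ 2)"
  unfolding induced_metric_def dmap_eq[OF assms] tangent_def lmetric_def
  by (simp add: algebra_simps power2_eq_square)

lemma gram_inverse:
  assumes "p \<in> strip I" "x1 (p $ 1) * y1 (p $ 1) \<noteq> 0" "y (p $ 1) \<noteq> 0"
  shows "matrix_inv (gram \<psi> p) = vector
    [vector [- 1 / (2 * x1 (p $ 1) * y1 (p $ 1)), 0], vector [0, 1 / (y (p $ 1))\<^sup>2]]"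
proof -
  have g: "gram \<psi> p = vector [vector [- 2 * x1 (p $ 1) * y1 (p $ 1), 0], vector [0, (y (p $ 1))\<^sup>2]]"
    by (simp add: gram_def induced_metric_eq[OF assms(1)] vec_eq_iff forall_2 axis_def)
  show ?thesis
    unfolding g using assms(2,3)
    by (intro matrix_inv_eqI; simp add: vec_eq_iff forall_2 matrix_matrix_mult_def sum_2 mat_def)
qed

lemma lmetric_normal_tangent:
  "lmetric (normal p) (tangent p v) = 0"
  unfolding lmetric_def normal_def tangent_def
  by (simp add: power2_eq_square) (simp add: algebra_simps)

text \<open>The coefficients of \<open>w\<close> in the orthogonal frame \<open>N, \<psi>\<^sub>s, \<psi>\<^sub>t\<close> are the inner products with the frame
  divided by the squared lengths \<open>2 x' y'\<close>, \<open>- 2 x' y'\<close> and \<open>y\<^sup>2\<close>.\<close>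

lemma normal_tangent_decomposition:
  assumes nz: "x1 (p $ 1) * y1 (p $ 1) \<noteq> 0" "y (p $ 1) \<noteq> 0"
  shows "w - (lmetric w (normal p) / (2 * x1 (p $ 1) * y1 (p $ 1))) *\<^sub>R normal p
    = tangent p (vector [- lmetric w (tangent p (axis 1 1)) / (2 * x1 (p $ 1) * y1 (p $ 1)),
        lmetric w (tangent p (axis 2 1)) / (y (p $ 1))\<^sup>2])"
proof -
  define t a b c where "t = p $ 2" and "a = x1 (p $ 1)" and "b = y1 (p $ 1)" and "c = y (p $ 1)"
  note d = t_def[symmetric] a_def[symmetric] b_def[symmetric] c_def[symmetric]
  have ab: "a \<noteq> 0" "b \<noteq> 0" "c \<noteq> 0" using nz by (auto simp: d)
  define k where "k = lmetric w (normal p) / (2 * a * b)"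
  define l where "l = - lmetric w (tangent p (axis 1 1)) / (2 * a * b)"
  define m where "m = lmetric w (tangent p (axis 2 1)) / c\<^sup>2"
  have N: "lmetric w (normal p) = - (w $ 1 * b) - w $ 2 * (- a + t\<^sup>2 / 2 * b) + w $ 3 * (t * b)"
    and S: "lmetric w (tangent p (axis 1 1)) = - (w $ 1 * b) - w $ 2 * (a + t\<^sup>2 / 2 * b) + w $ 3 * (t * b)"
    and T: "lmetric w (tangent p (axis 2 1)) = (w $ 3 - w $ 2 * t) * c"
    by (simp_all add: lmetric_def normal_def tangent_def axis_def d algebra_simps)
  \<comment> \<open>\<open>N\<close> and \<open>\<psi>\<^sub>s\<close> differ only in the sign of \<open>x'\<close>, so sum and difference of their coefficients are simple.\<close>
  have 1: "b * k + b * l = w $ 2"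
    unfolding k_def l_def N S using ab by (simp add: field_simps)
  have 2: "a * l - a * k = w $ 1 + w $ 2 * (t\<^sup>2 / 2) - w $ 3 * t"
    unfolding k_def l_def N S using ab by (simp add: field_simps)
  have 3: "c * m = w $ 3 - w $ 2 * t"
    unfolding m_def T using ab by (simp add: power2_eq_square)
  have "w $ 2 = k * b + l * b" using 1 by (simp add: algebra_simps)
  moreover have "w $ 3 = k * (t * b) + (l * (t * b) + m * c)"
    using arg_cong[OF 1, of "\<lambda>u. t * u"] 3 by (simp add: algebra_simps)
  moreover have "w $ 1 = k * (- a + t\<^sup>2 / 2 * b) + (l * (a + t\<^sup>2 / 2 * b) + m * (t * c))"
    using arg_cong[OF 1, of "\<lambda>u. t\<^sup>2 / 2 * u"] 2 arg_cong[OF 3, of "\<lambda>u. t * u"]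
    by (simp add: algebra_simps power2_eq_square)
  ultimately have "w - k *\<^sub>R normal p = tangent p (vector [l, m])"
    by (simp add: vec_eq_iff forall_3 normal_def tangent_def d)
  then show ?thesis
    by (simp only: k_def l_def m_def a_def b_def c_def)
qed

text \<open>The decomposition gives existence. Uniqueness holds because two candidates differ by a vector
  that is both tangent and normal, and the metric on the tangent plane is non-degenerate.\<close>

lemma normal_proj_eq:
  assumes p: "p \<in> strip I" and nz: "x1 (p $ 1) * y1 (p $ 1) \<noteq> 0" "y (p $ 1) \<noteq> 0"
  shows "normal_proj \<psi> p w
    = (lmetric w (normal p) / (2 * x1 (p $ 1) * y1 (p $ 1))) *\<^sub>R normal p"
    (is "_ = ?n")
  unfolding normal_proj_def
proof (rule the_equality)
  define n where "n = ?n"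
  have n: "n \<in> normal_space \<psi> p"
    using lmetric_normal_tangent[of p]
    by (simp add: n_def normal_space_def dmap_eq[OF p] lmetric_scaleR)
  moreover have r: "w - n \<in> range (dmap \<psi> p)"
    using normal_tangent_decomposition[OF nz, of w] unfolding n_def dmap_eq(2)[OF p] by blast
  ultimately show "?n \<in> normal_space \<psi> p \<and> w - ?n \<in> range (dmap \<psi> p)"
    unfolding n_def by blast
  fix m assume m: "m \<in> normal_space \<psi> p \<and> w - m \<in> range (dmap \<psi> p)"
  have lin: "linear (dmap \<psi> p)"
    using dmap_eq[OF p] by (metis has_derivative_linear)
  obtain a b where "w - m = dmap \<psi> p a" "w - n = dmap \<psi> p b" using m r by blast
  then have d: "n - m = dmap \<psi> p (a - b)"
    unfolding linear_diff[OF lin] by (metis diff_diff_eq2 diff_add_cancel add_diff_cancel_left')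
  have "induced_metric \<psi> p (a - b) v = 0" for v
    using m n unfolding induced_metric_def d[symmetric] normal_space_def
    by (simp add: lmetric_diff)
  from this[of "axis 1 1"] this[of "axis 2 1"] have "a - b = 0"
    using nz by (simp add: induced_metric_eq[OF p] vec_eq_iff forall_2 axis_def)
  then have "m = n" using d linear_0[OF lin] by simp
  then show "m = ?n" unfolding n_def .
qed

lemma nondegenerate_imp:
  assumes "nondegenerate_on (strip I) \<psi>" "s \<in> I"
  shows "x1 s * y1 s \<noteq> 0"
proof
  assume 0: "x1 s * y1 s = 0"
  define p where "p = (vector [s, 0] :: real ^ 2)"
  have p: "p \<in> strip I" "p $ 1 = s" using assms(2) by (auto simp: strip_def p_def)
  have "induced_metric \<psi> p (axis 1 1) v = 0" for v
    using 0 by (simp add: induced_metric_eq[OF p(1)] p(2) axis_def)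
  then have "(axis 1 1 :: real ^ 2) = 0" using assms(1) p(1) unfolding nondegenerate_on_def by blast
  then show False by (simp add: axis_eq_0_iff)
qed

text \<open>The Gram matrix is diagonal, so the mixed derivative \<open>\<psi>\<^sub>s\<^sub>t\<close> does not contribute. The other two
  enter through \<open>\<langle>\<psi>\<^sub>s\<^sub>s, N\<rangle> = x' y'' - x'' y'\<close> and \<open>\<langle>\<psi>\<^sub>t\<^sub>t, N\<rangle> = - y y'\<close>.\<close>

lemma mean_curvature_vector_eq:
  assumes p: "p \<in> strip I" and nz: "x1 (p $ 1) * y1 (p $ 1) \<noteq> 0" "y (p $ 1) \<noteq> 0"
  shows "mean_curvature_vector \<psi> p =
    ((- 1 / (2 * x1 (p $ 1) * y1 (p $ 1)))
        * ((x1 (p $ 1) * y2 (p $ 1) - x2 (p $ 1) * y1 (p $ 1)) / (2 * x1 (p $ 1) * y1 (p $ 1)))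
     + 1 / (y (p $ 1))\<^sup>2 * (- (y (p $ 1) * y1 (p $ 1)) / (2 * x1 (p $ 1) * y1 (p $ 1)))) *\<^sub>R normal p"
proof -
  have "lmetric (frechet_derivative (\<lambda>q. dmap \<psi> q (axis 1 1)) (at p) (axis 1 1)) (normal p)
      = x1 (p $ 1) * y2 (p $ 1) - x2 (p $ 1) * y1 (p $ 1)"
    unfolding second_derivative_eq[OF p] by (simp add: lmetric_def normal_def axis_def algebra_simps power2_eq_square)
  moreover have "lmetric (frechet_derivative (\<lambda>q. dmap \<psi> q (axis 2 1)) (at p) (axis 2 1)) (normal p)
      = - (y (p $ 1) * y1 (p $ 1))"
    unfolding second_derivative_eq[OF p] by (simp add: lmetric_def normal_def axis_def)
  ultimately show ?thesis
    unfolding mean_curvature_vector_def second_fundamental_form_def gram_inverse[OF p nz]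
      normal_proj_eq[OF p nz] sum_2 vector_2
    by (simp only: mult_zero_left scaleR_zero_left scaleR_scaleR add_0_left add_0_right scaleR_add_left)
qed

text \<open>Both sides of \<open>H = K\<^sup>\<bottom>\<close> are multiples of \<open>N\<close>, and \<open>\<langle>K, N\<rangle> = - y'\<close>. The group
  preserves the surface and fixes \<open>K\<close>, so nothing is lost by evaluating at \<open>t = 0\<close>.\<close>

lemma soliton_equation:
  assumes sol: "translating_soliton (vector [1, 0, 0]) (strip I) \<psi>"
    and s: "s \<in> I" and y: "y s \<noteq> 0"
  shows "x2 s * y1 s - x1 s * y2 s = 2 * x1 s * y1 s * (y1 s / y s - y1 s)"
proof -
  \<comment> \<open>The equation of the coefficients of \<open>N\<close> after division by \<open>\<langle>N, N\<rangle>\<close>, with \<open>q = 2 x' y'\<close>, \<open>b = y'\<close>,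
    \<open>c = y\<close> and \<open>E = x' y'' - x'' y'\<close>.\<close>
  have balance: "- E = q * (b / c - b)"
    if eq: "- 1 / q * (E / q) + 1 / c\<^sup>2 * (- (c * b) / q) = - b / q" and "q \<noteq> 0" "c \<noteq> 0"
    for E q b c :: real
  proof -
    define e r where "e = E / q" and "r = b / c"
    have E: "E = e * q" and b: "b = r * c" using that by (simp_all add: e_def r_def)
    have "1 / c\<^sup>2 * (- (c * (r * c)) / q) = - r / q"
      using that(3) by (simp add: power2_eq_square)
    with eq have "- 1 / q * (E / q) + - r / q = - b / q" unfolding b by argo
    then have "(- e - r) / q = (- b) / q" unfolding e_def by (simp add: diff_divide_distrib)
    then have "- e - r = - b" unfolding divide_cancel_right using that(2) by blast
    then have e: "e = b - r" by linarith
    show ?thesis unfolding E e r_def[symmetric] by (simp add: algebra_simps)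
  qed
  have nz: "x1 s * y1 s \<noteq> 0"
    using nondegenerate_imp sol s by (auto simp: translating_soliton_def)
  define p where "p = (vector [s, 0] :: real ^ 2)"
  have p: "p \<in> strip I" and ps: "p $ 1 = s" using s by (auto simp: strip_def p_def)
  have K: "lmetric (vector [1, 0, 0]) (normal p) = - y1 s"
    by (simp add: lmetric_def normal_def ps)
  have "normal p $ 2 = y1 s"
    by (simp add: normal_def ps)
  then have N: "normal p \<noteq> 0" using nz by (metis mult_zero_right zero_index)
  have "mean_curvature_vector \<psi> p = normal_proj \<psi> p (vector [1, 0, 0])"
    using sol p unfolding translating_soliton_def by blast
  then have "(- 1 / (2 * x1 s * y1 s) * ((x1 s * y2 s - x2 s * y1 s) / (2 * x1 s * y1 s))
      + 1 / (y s)\<^sup>2 * (- (y s * y1 s) / (2 * x1 s * y1 s))) *\<^sub>R normal p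
      = (lmetric (vector [1, 0, 0]) (normal p) / (2 * x1 s * y1 s)) *\<^sub>R normal p"
    using mean_curvature_vector_eq[OF p] normal_proj_eq[OF p] nz y unfolding ps by metis
  then have "- 1 / (2 * x1 s * y1 s) * ((x1 s * y2 s - x2 s * y1 s) / (2 * x1 s * y1 s))
      + 1 / (y s)\<^sup>2 * (- (y s * y1 s) / (2 * x1 s * y1 s)) = - y1 s / (2 * x1 s * y1 s)"
    unfolding scaleR_cancel_right K using N by blast
  then have "- (x1 s * y2 s - x2 s * y1 s) = 2 * x1 s * y1 s * (y1 s / y s - y1 s)"
    by (rule balance) (use nz y in auto)
  then show ?thesis by simp
qed

lemma space_like:
  assumes "\<And>s. s \<in> I \<Longrightarrow> x1 s * y1 s < 0" "\<And>s. s \<in> I \<Longrightarrow> y s \<noteq> 0"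
  shows "space_like_on (strip I) \<psi>"
  unfolding space_like_on_def
proof (intro ballI allI impI)
  fix p u :: "real ^ 2" assume p: "p \<in> strip I" and "u \<noteq> 0"
  then have s: "p $ 1 \<in> I" by (simp add: strip_def)
  have "0 < - 2 * (x1 (p $ 1) * y1 (p $ 1))" "0 < (y (p $ 1))\<^sup>2"
    using assms[OF s] by auto
  moreover have "u $ 1 \<noteq> 0 \<or> u $ 2 \<noteq> 0" using \<open>u \<noteq> 0\<close> by (auto simp: vec_eq_iff forall_2)
  ultimately have "0 < (- 2 * (x1 (p $ 1) * y1 (p $ 1))) * (u $ 1)\<^sup>2 + (y (p $ 1))\<^sup>2 * (u $ 2)\<^sup>2"
    by (metis add_nonneg_pos add_pos_nonneg less_imp_le mult_nonneg_nonneg mult_pos_pos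
        zero_le_power2 zero_less_power2)
  then show "0 < induced_metric \<psi> p u u"
    by (simp add: induced_metric_eq[OF p] power2_eq_square mult.assoc)
qed

lemma time_like:
  assumes "\<And>s. s \<in> I \<Longrightarrow> x1 s * y1 s > 0" "\<And>s. s \<in> I \<Longrightarrow> y s \<noteq> 0"
  shows "time_like_on (strip I) \<psi>"
  unfolding time_like_on_def
proof (rule ballI)
  fix p :: "real ^ 2" assume p: "p \<in> strip I"
  then have s: "p $ 1 \<in> I" by (simp add: strip_def)
  define r where "r = 1 / sqrt (2 * (x1 (p $ 1) * y1 (p $ 1)))"
  have "r\<^sup>2 = 1 / (2 * (x1 (p $ 1) * y1 (p $ 1)))"
    using assms(1)[OF s] by (simp add: r_def power_divide)
  then have "2 * x1 (p $ 1) * y1 (p $ 1) * (r * r) = 1"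
    using assms(1)[OF s] by (auto simp: power2_eq_square)
  then have "induced_metric \<psi> p (vector [r, 0]) (vector [r, 0]) = - 1"
    by (simp add: induced_metric_eq[OF p])
  moreover have "induced_metric \<psi> p (vector [0, 1 / y (p $ 1)]) (vector [0, 1 / y (p $ 1)]) = 1"
    using assms(2)[OF s] by (simp add: induced_metric_eq[OF p] power2_eq_square)
  moreover have "induced_metric \<psi> p (vector [r, 0]) (vector [0, 1 / y (p $ 1)]) = 0"
    by (simp add: induced_metric_eq[OF p])
  ultimately show "\<exists>u v. induced_metric \<psi> p u u = - 1 \<and> induced_metric \<psi> p v v = 1
      \<and> induced_metric \<psi> p u v = 0"
    by blast
qed

lemma not_space_like_and_time_like:
  assumes "I \<noteq> {}" "space_like_on (strip I) \<psi>" "time_like_on (strip I) \<psi>"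
  shows False
proof -
  obtain s where "s \<in> I" using assms(1) by blast
  then have p: "vector [s, 0] \<in> strip I" by (simp add: strip_def)
  then obtain u where u: "induced_metric \<psi> (vector [s, 0]) u u = - 1"
    using assms(3) unfolding time_like_on_def by blast
  then have "u \<noteq> 0" by (auto simp: induced_metric_eq[OF p])
  then have "0 < induced_metric \<psi> (vector [s, 0]) u u"
    using assms(2) p unfolding space_like_on_def by blast
  then show False using u by simp
qed

text \<open>The soliton equation says that \<open>Q = x' exp (2 y) / (y' y\<^sup>2)\<close> has zero derivative; then the
  resulting formula for \<open>x'\<close> is the chain rule for \<open>a * phi (y s)\<close>.\<close>

lemma soliton_first_integral:
  assumes sol: "translating_soliton (vector [1, 0, 0]) (strip I) \<psi>"
    and I: "is_interval I" "I \<noteq> {}" and y: "\<And>s. s \<in> I \<Longrightarrow> y s \<noteq> 0"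
  obtains a k where "a \<noteq> 0"
    "\<And>s. s \<in> I \<Longrightarrow> x1 s = a * (- 4 * (y s)\<^sup>2 * exp (- 2 * y s) * y1 s)"
    "\<And>s. s \<in> I \<Longrightarrow> x s = a * phi (y s) + k"
proof -
  have nz: "x1 s \<noteq> 0" "y1 s \<noteq> 0" if "s \<in> I" for s
    using nondegenerate_imp[OF _ that] sol by (auto simp: translating_soliton_def)
  define Q where "Q s = x1 s * exp (2 * y s) / (y1 s * (y s)\<^sup>2)" for s
  have "(Q has_real_derivative 0) (at s within I)" if s: "s \<in> I" for s
  proof -
    have "(x2 s * y1 s - x1 s * y2 s) * y s = 2 * x1 s * y1 s * (y1 s - y1 s * y s)"
      using soliton_equation[OF sol s y[OF s]] y[OF s] by (simp add: field_simps)
    from arg_cong[OF this, of "\<lambda>u. exp (2 * y s) * y s * u"]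
    have "(x1 s * (exp (2 * y s) * (2 * y1 s)) + x2 s * exp (2 * y s)) * (y1 s * (y s)\<^sup>2)
        = (x1 s * exp (2 * y s)) * (y1 s * (2 * y s * y1 s) + y2 s * (y s)\<^sup>2)"
      by (simp add: algebra_simps power2_eq_square)
    moreover have "((\<lambda>s. x1 s * exp (2 * y s)) has_real_derivative
        x1 s * (exp (2 * y s) * (2 * y1 s)) + x2 s * exp (2 * y s)) (at s)"
      by (rule DERIV_mult'[OF x2[OF s] DERIV_chain2[OF DERIV_exp DERIV_cmult[OF y1[OF s]]]])
    moreover have "((\<lambda>s. y1 s * (y s)\<^sup>2) has_real_derivative
        y1 s * (2 * y s * y1 s) + y2 s * (y s)\<^sup>2) (at s)"
      by (rule DERIV_mult'[OF y2[OF s]]) (rule derivative_eq_intros y1[OF s] refl | simp)+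
    ultimately have "(Q has_real_derivative 0) (at s)"
      unfolding Q_def using DERIV_divide[where x = s] y[OF s] nz[OF s] by fastforce
    then show ?thesis by (rule has_field_derivative_at_within)
  qed
  then obtain c where c: "\<And>s. s \<in> I \<Longrightarrow> Q s = c"
    using has_field_derivative_zero_constant[of I Q] I(1) is_interval_convex by metis
  \<comment> \<open>The factor \<open>- 4\<close> is the one in the derivative \<open>- 4 r\<^sup>2 exp (- 2 r)\<close> of \<open>phi\<close>.\<close>
  define a where "a = - c / 4"
  have x1_eq: "x1 s = a * (- 4 * (y s)\<^sup>2 * exp (- 2 * y s) * y1 s)" if s: "s \<in> I" for s
  proof -
    have "x1 s * exp (2 * y s) = c * (y1 s * (y s)\<^sup>2)"
      using c[OF s] y[OF s] nz[OF s] unfolding Q_def by (simp add: divide_eq_eq)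
    then have "x1 s = c * (y1 s * (y s)\<^sup>2) / exp (2 * y s)"
      by (simp add: eq_divide_eq)
    then show ?thesis by (simp add: a_def exp_minus field_simps)
  qed
  have "((\<lambda>s. x s - a * phi (y s)) has_real_derivative 0) (at s within I)" if s: "s \<in> I" for s
  proof -
    have "((\<lambda>s. phi (y s)) has_real_derivative - 4 * (y s)\<^sup>2 * exp (- 2 * y s) * y1 s) (at s)"
      by (rule DERIV_chain2[OF phi_deriv y1[OF s]])
    from DERIV_diff[OF x1[OF s] DERIV_cmult[OF this, of a]]
    show ?thesis using x1_eq[OF s] by (simp add: has_field_derivative_at_within)
  qed
  then obtain k where "\<And>s. s \<in> I \<Longrightarrow> x s - a * phi (y s) = k"
    using has_field_derivative_zero_constant[of I "\<lambda>s. x s - a * phi (y s)"] I(1) is_interval_convex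
    by metis
  moreover have "a \<noteq> 0" using x1_eq nz(1) I(2) by force
  ultimately show ?thesis using that[of a k] x1_eq by (metis add.commute diff_add_cancel)
qed

lemma causal_character_iff:
  assumes "I \<noteq> {}" "a \<noteq> 0" and y: "\<And>s. s \<in> I \<Longrightarrow> y s \<noteq> 0" "\<And>s. s \<in> I \<Longrightarrow> y1 s \<noteq> 0"
    and x: "\<And>s. s \<in> I \<Longrightarrow> x1 s = a * (- 4 * (y s)\<^sup>2 * exp (- 2 * y s) * y1 s)"
  shows "space_like_on (strip I) \<psi> \<longleftrightarrow> a > 0" "time_like_on (strip I) \<psi> \<longleftrightarrow> a < 0"
proof -
  have eq: "x1 s * y1 s = - a * (4 * (y s * y1 s)\<^sup>2 * exp (- 2 * y s))" if "s \<in> I" for s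
    using x[OF that] by (simp add: power2_eq_square)
  have pos: "4 * (y s * y1 s)\<^sup>2 * exp (- 2 * y s) > 0" if "s \<in> I" for s
    using y[OF that] by simp
  have "space_like_on (strip I) \<psi>" if "a > 0"
    by (rule space_like) (use that eq pos y(1) in \<open>metis mult_neg_pos neg_less_0_iff_less\<close>)+
  moreover have "time_like_on (strip I) \<psi>" if "a < 0"
    by (rule time_like) (use that eq pos y(1) in \<open>metis mult_pos_pos neg_0_less_iff_less\<close>)+
  ultimately show "space_like_on (strip I) \<psi> \<longleftrightarrow> a > 0" "time_like_on (strip I) \<psi> \<longleftrightarrow> a < 0"
    using not_space_like_and_time_like[OF assms(1)] assms(2) by (meson linorder_less_linear)+
qed

end


section \<open>Classification of the profile curves\<close>

lemma has_real_derivative_component: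
  fixes f :: "real \<Rightarrow> real ^ 'n"
  assumes "f differentiable (at s)"
  shows "((\<lambda>s. f s $ i) has_real_derivative frechet_derivative f (at s) 1 $ i) (at s)"
proof -
  have D: "(f has_derivative frechet_derivative f (at s)) (at s)"
    using assms by (simp add: frechet_derivative_works)
  have "frechet_derivative f (at s) h $ i = frechet_derivative f (at s) 1 $ i * h" for h
    using arg_cong[OF linear_scale[OF has_derivative_linear[OF D], of h 1], of "\<lambda>v. v $ i"]
    by (simp add: mult.commute)
  then have "(\<lambda>h. frechet_derivative f (at s) h $ i) = (*) (frechet_derivative f (at s) 1 $ i)"
    by (rule ext)
  with bounded_linear.has_derivative[OF bounded_linear_vec_nth D, of i] show ?thesis
    by (simp add: has_field_derivative_def)
qed

lemma profile_twice_differentiable: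
  assumes "open I" "profile_curve_on I x y"
  obtains x1 y1 x2 y2 where "A3_twice_differentiable I x y x1 y1 x2 y2"
proof
  let ?P = "profile x y"
  let ?P1 = "\<lambda>s. frechet_derivative ?P (at s) 1"
  have "Ck_on (Suc (Suc 0)) I ?P"
    using assms(2) unfolding profile_curve_on_def smooth_on_def by blast
  then have P: "?P differentiable (at s)" "?P1 differentiable (at s)" if "s \<in> I" for s
    using that by simp_all
  show "A3_twice_differentiable I x y (\<lambda>s. ?P1 s $ 1) (\<lambda>s. ?P1 s $ 2)
    (\<lambda>s. frechet_derivative ?P1 (at s) 1 $ 1) (\<lambda>s. frechet_derivative ?P1 (at s) 1 $ 2)"
  proof
    fix s assume s: "s \<in> I"
    show "(x has_real_derivative ?P1 s $ 1) (at s)" "(y has_real_derivative ?P1 s $ 2) (at s)"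
      using has_real_derivative_component[OF P(1)[OF s], of 1]
        has_real_derivative_component[OF P(1)[OF s], of 2]
      by (simp_all add: profile_def)
  qed (use assms(1) P(2) has_real_derivative_component in auto)
qed

theorem theorem4p2:
  fixes I :: "real set" and x y :: "real \<Rightarrow> real"
  assumes "open I" and "is_interval I" and "I \<noteq> {}"
    and "profile_curve_on I x y"
    and "translating_soliton (vector [1, 0, 0]) (strip I) (A3_surface x y)"
  shows "((\<forall>s\<in>I. y s = s) \<longrightarrow>
      (\<exists>a0 a1. a0 \<noteq> 0 \<and>
        (\<forall>s\<in>I. x s = a0 * (2 * s\<^sup>2 + 2 * s + 1) * exp (- 2 * s) + a1) \<and>
        (space_like_on (strip I) (A3_surface x y) \<longleftrightarrow> a0 > 0) \<and>
        (time_like_on (strip I) (A3_surface x y) \<longleftrightarrow> a0 < 0)))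
    \<and>
    (homeomorphism UNIV {0<..} phi (inv phi) \<and> smooth_on UNIV phi \<and>
      diffeomorphism (- {0}) ({0<..} - {1}) phi (inv phi))
    \<and>
    ((\<forall>s\<in>I. x s = s) \<longrightarrow>
      (\<exists>b2 b3. b2 \<noteq> 0 \<and>
        (b2 > 0 \<longrightarrow> I \<subseteq> {..< b3 / (4 * b2)} - {(b3 - 1) / (4 * b2)}) \<and>
        (b2 < 0 \<longrightarrow> I \<subseteq> {b3 / (4 * b2) <..} - {(b3 - 1) / (4 * b2)}) \<and>
        (\<forall>s\<in>I. y s = inv phi (- 4 * b2 * s + b3)) \<and>
        (space_like_on (strip I) (A3_surface x y) \<longleftrightarrow> b2 < 0) \<and>
        (time_like_on (strip I) (A3_surface x y) \<longleftrightarrow> b2 > 0)))"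
proof -
  have y: "y s \<noteq> 0" if "s \<in> I" for s
    using assms(4) that unfolding profile_curve_on_def by (metis order_less_irrefl)
  obtain x1 y1 x2 y2 where "A3_twice_differentiable I x y x1 y1 x2 y2"
    using profile_twice_differentiable[OF assms(1,4)] .
  then interpret A3_twice_differentiable I x y x1 y1 x2 y2 .
  obtain a k where a: "a \<noteq> 0"
    and x1_eq: "\<And>s. s \<in> I \<Longrightarrow> x1 s = a * (- 4 * (y s)\<^sup>2 * exp (- 2 * y s) * y1 s)"
    and x_eq: "\<And>s. s \<in> I \<Longrightarrow> x s = a * phi (y s) + k"
    using soliton_first_integral[OF assms(5,2,3) y] by blast
  have "y1 s \<noteq> 0" if "s \<in> I" for s
    using nondegenerate_imp[OF _ that] assms(5) by (auto simp: translating_soliton_def)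
  note causal = causal_character_iff[OF assms(3) a y this x1_eq]
  have "\<exists>a0 a1. a0 \<noteq> 0 \<and>
        (\<forall>s\<in>I. x s = a0 * (2 * s\<^sup>2 + 2 * s + 1) * exp (- 2 * s) + a1) \<and>
        (space_like_on (strip I) (A3_surface x y) \<longleftrightarrow> a0 > 0) \<and>
        (time_like_on (strip I) (A3_surface x y) \<longleftrightarrow> a0 < 0)"
    if "\<forall>s\<in>I. y s = s"
    by (rule exI[of _ a], rule exI[of _ k]) (use that a x_eq causal in \<open>simp add: phi_def\<close>)
  moreover have "\<exists>b2 b3. b2 \<noteq> 0 \<and>
        (b2 > 0 \<longrightarrow> I \<subseteq> {..< b3 / (4 * b2)} - {(b3 - 1) / (4 * b2)}) \<and>
        (b2 < 0 \<longrightarrow> I \<subseteq> {b3 / (4 * b2) <..} - {(b3 - 1) / (4 * b2)}) \<and>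
        (\<forall>s\<in>I. y s = inv phi (- 4 * b2 * s + b3)) \<and>
        (space_like_on (strip I) (A3_surface x y) \<longleftrightarrow> b2 < 0) \<and>
        (time_like_on (strip I) (A3_surface x y) \<longleftrightarrow> b2 > 0)"
    if x: "\<forall>s\<in>I. x s = s"
  proof (rule exI[of _ "- 1 / (4 * a)"], rule exI[of _ "- k / a"], intro conjI impI)
    \<comment> \<open>Solving \<open>s = a * phi (y s) + k\<close> for \<open>phi (y s)\<close> and matching coefficients.\<close>
    let ?b2 = "- 1 / (4 * a)" and ?b3 = "- k / a"
    have phi_y: "- 4 * ?b2 * s + ?b3 = phi (y s)" if "s \<in> I" for s
      using x_eq[OF that] x that a by (simp add: field_simps)
    \<comment> \<open>The excluded point is where \<open>phi (y s) = 1\<close>, that is \<open>y s = 0\<close>.\<close>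
    have ne: "s \<noteq> (?b3 - 1) / (4 * ?b2)" if "s \<in> I" for s
    proof
      assume "s = (?b3 - 1) / (4 * ?b2)"
      then have "phi (y s) = phi 0"
        unfolding phi_y[OF that, symmetric] using a by (simp add: field_simps)
      then show False using y[OF that] injD[OF inj_phi] by blast
    qed
    show "?b2 \<noteq> 0" using a by simp
    show "\<forall>s\<in>I. y s = inv phi (- 4 * ?b2 * s + ?b3)"
      by (rule ballI) (simp only: phi_y inv_phi_phi)
    show "space_like_on (strip I) (A3_surface x y) \<longleftrightarrow> ?b2 < 0"
      "time_like_on (strip I) (A3_surface x y) \<longleftrightarrow> ?b2 > 0"
      using causal a by (simp_all add: divide_less_0_iff zero_less_divide_iff)
    \<comment> \<open>The half line for \<open>I\<close> is the positivity of \<open>phi\<close>.\<close>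
    have pos: "4 * ?b2 * s < ?b3" if "s \<in> I" for s
      using phi_pos[of "y s"] unfolding phi_y[OF that, symmetric] by simp
    show "I \<subseteq> {..< ?b3 / (4 * ?b2)} - {(?b3 - 1) / (4 * ?b2)}" if "?b2 > 0"
    proof
      fix s assume s: "s \<in> I"
      have "s < ?b3 / (4 * ?b2)"
        using pos[OF s] that by (subst pos_less_divide_eq) (simp_all add: mult.commute)
      then show "s \<in> {..< ?b3 / (4 * ?b2)} - {(?b3 - 1) / (4 * ?b2)}" using ne[OF s] by simp
    qed
    show "I \<subseteq> {?b3 / (4 * ?b2) <..} - {(?b3 - 1) / (4 * ?b2)}" if "?b2 < 0"
    proof
      fix s assume s: "s \<in> I"
      have "?b3 / (4 * ?b2) < s"
        using pos[OF s] that by (subst neg_divide_less_eq) (simp_all add: mult.commute)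
      then show "s \<in> {?b3 / (4 * ?b2) <..} - {(?b3 - 1) / (4 * ?b2)}" using ne[OF s] by simp
    qed
  qed
  ultimately show ?thesis
    using homeomorphism_phi smooth_on_phi[OF open_UNIV] diffeomorphism_phi by blast
qed

end
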